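(* Let $G$ be a simple graph of order $n$ and let $k$ be an integer with $1\le k\le n-1$. Suppose $\nu(G)=\lfloor n/2\rfloor$. Then: (1) if $n$ is even and $k$ is odd, $\nu(F_k(G))=\binom{n}{k}/2$; (2) if $n$ is even and $k$ is even, $\nu(F_k(G))\ge \big(\binom{n}{k}-\binom{n/2}{k/2}\big)/2$; (3) if $n$ is odd, $\nu(F_k(G))\ge \big(\binom{n}{k}-\binom{(n-1)/2}{\lfloor k/2\rfloor}\big)/2$. Moreover, if $G$ itself is a perfect matching (i.e. $n$ is even and $G$ consists of $n/2$ pairwise disjoint edges), then equality holds in (2); and if $G$ itself is an almost perfect matching (i.e. $n$ is odd and $G$ consists of $(n-1)/2$ pairwise disjoint edges together with one isolated vertex), then equality holds in (3).
   Context: For a simple finite graph $G$ of order $n$ and an integer $1\le k\le n-1$, the $k$-token graph $F_k(G)$ is the graph whose vertices are all $k$-element subsets of $V(G)$, two such subsets $A,B$ being adjacent iff their symmetric difference $A\triangle B$ is an edge of $G$. $\nu(H)$ denotes the matching number of a graph $H$ (the maximum number of edges in a matching). *)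

theory Defs
  imports Complex_Main "HOL-Library.Ramsey"
begin

type_synonym 'a ugraph = "'a set \<times> 'a set set"

abbreviation verts :: "'a ugraph \<Rightarrow> 'a set" where
  "verts G \<equiv> fst G"

abbreviation edges :: "'a ugraph \<Rightarrow> 'a set set" where
  "edges G \<equiv> snd G"

definition simple_graph :: "'a ugraph \<Rightarrow> bool" where
  "simple_graph G \<longleftrightarrow> finite (verts G) \<and> edges G \<subseteq> [verts G]\<^bsup>2\<^esup>"

(* If G is simple, then {} is not an edge of G, so the condition on the
   symmetric difference forces A and B to be distinct. *)
definition token_graph :: "nat \<Rightarrow> 'a ugraph \<Rightarrow> 'a set ugraph" where
  "token_graph k G =
    ([verts G]\<^bsup>k\<^esup>,
     {{A, B} | A B. A \<in> [verts G]\<^bsup>k\<^esup> \<and> B \<in> [verts G]\<^bsup>k\<^esup> \<and> sym_diff A B \<in> edges G})"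

definition matching :: "'a ugraph \<Rightarrow> 'a set set \<Rightarrow> bool" where
  "matching G M \<longleftrightarrow> M \<subseteq> edges G \<and> pairwise disjnt M"

definition matching_number :: "'a ugraph \<Rightarrow> nat" where
  "matching_number G = Max (card ` {M. matching G M})"

definition is_perfect_matching :: "'a ugraph \<Rightarrow> bool" where
  "is_perfect_matching G \<longleftrightarrow>
    even (card (verts G)) \<and> pairwise disjnt (edges G) \<and>
    card (edges G) = card (verts G) div 2 \<and> \<Union>(edges G) = verts G"

definition is_almost_perfect_matching :: "'a ugraph \<Rightarrow> bool" where
  "is_almost_perfect_matching G \<longleftrightarrow>
    odd (card (verts G)) \<and> pairwise disjnt (edges G) \<and>
    card (edges G) = (card (verts G) - 1) div 2 \<and>
    (\<exists>v \<in> verts G. \<Union>(edges G) = verts G - {v})"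

lemma simple_graph_token_graph:
  assumes "simple_graph G"
  shows "simple_graph (token_graph k G)"
proof -
  have "A \<noteq> B" if "sym_diff A B \<in> edges G" for A B
    using that assms by (auto simp: simple_graph_def nsets_def)
  moreover have "finite ([verts G]\<^bsup>k\<^esup>)"
    using assms by (simp add: simple_graph_def finite_imp_finite_nsets)
  ultimately show ?thesis
    by (fastforce simp: simple_graph_def token_graph_def nsets_def[of _ 2])
qed

lemma finite_matchings:
  assumes "simple_graph G"
  shows "finite {M. matching G M}"
proof -
  have "finite (edges G)"
    using assms finite_imp_finite_nsets finite_subset by (auto simp: simple_graph_def)
  then show ?thesis
    by (rule finite_subset[rotated, OF finite_Pow_iff[THEN iffD2]]) (auto simp: matching_def)
qed

end

theory Submission
  imports Defs
begin

text \<open>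
  Let \<open>M\<close> be a maximum matching of \<open>G\<close>. An edge \<open>e \<in> M\<close> crosses a set \<open>A\<close> if exactly one endpoint
  of \<open>e\<close> lies in \<open>A\<close>; moving the token along \<open>e\<close> replaces \<open>A\<close> by the symmetric difference of \<open>A\<close>
  and \<open>e\<close>, which is crossed by the same edges of \<open>M\<close>. Hence moving the token along an edge chosen as
  a function of the set of crossing edges is a fixed-point-free involution, i.e. a perfect matching,
  on the \<open>k\<close>-sets crossed by at least one edge of \<open>M\<close>. The remaining \<open>k\<close>-sets are unions of edges
  of \<open>M\<close>, together with the vertex missed by \<open>M\<close> if \<open>k\<close> is odd, and are counted by a binomial
  coefficient. If \<open>M\<close> contains all edges of \<open>G\<close>, they are isolated in the token graph.
\<close>

section \<open>Matchings and the number of vertices they cover\<close>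

lemma card_matching_le_matching_number:
  assumes "simple_graph H" "matching H M"
  shows "card M \<le> matching_number H"
  unfolding matching_number_def using assms by (intro Max_ge) (auto simp: finite_matchings)

lemma obtain_maximum_matching:
  assumes "simple_graph H"
  obtains M where "matching H M" "card M = matching_number H"
proof -
  have "matching H {}" by (simp add: matching_def)
  then have "matching_number H \<in> card ` {M. matching H M}"
    unfolding matching_number_def using assms by (intro Max_in) (auto simp: finite_matchings)
  then show ?thesis using that by auto
qed

lemma card_Union_pairs:
  assumes "finite M" "pairwise disjnt M" "\<And>e. e \<in> M \<Longrightarrow> card e = 2"
  shows "card (\<Union>M) = 2 * card M"
proof -
  have "card (\<Union>M) = (\<Sum>e\<in>M. card e)"
    using assms by (intro card_Union_disjoint) (auto simp: card_ge_0_finite)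
  then show ?thesis using assms(3) by simp
qed

lemma matching_facts:
  assumes "simple_graph H" "matching H M"
  shows "finite M" "pairwise disjnt M" "\<And>e. e \<in> M \<Longrightarrow> card e = 2" "\<Union>M \<subseteq> verts H"
proof -
  have "M \<subseteq> [verts H]\<^bsup>2\<^esup>" "finite (verts H)"
    using assms by (auto simp: simple_graph_def matching_def)
  then show "\<And>e. e \<in> M \<Longrightarrow> card e = 2" "\<Union>M \<subseteq> verts H"
    by (auto simp: nsets_def)
  show "finite M"
    using \<open>M \<subseteq> _\<close> finite_imp_finite_nsets[OF \<open>finite (verts H)\<close>] by (rule finite_subset)
  show "pairwise disjnt M" using assms by (simp add: matching_def)
qed

text \<open>A matching covers two vertices per edge, and each covered vertex lies in
  \<open>S\<close>. All upper bounds come from here, with \<open>S\<close> either all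
  \<open>k\<close>-sets or only the crossed ones.\<close>

lemma matching_number_le_half_support:
  assumes "simple_graph H" "finite S" "\<Union>(edges H) \<subseteq> S"
  shows "2 * matching_number H \<le> card S"
proof -
  obtain M where M: "matching H M" "card M = matching_number H"
    using obtain_maximum_matching[OF assms(1)] .
  have "\<Union>M \<subseteq> S" using M(1) assms(3) by (auto simp: matching_def)
  then have "card (\<Union>M) \<le> card S" by (rule card_mono[OF assms(2)])
  then show ?thesis
    using card_Union_pairs[OF matching_facts(1-3)[OF assms(1) M(1)]] M(2) by simp
qed

section \<open>Involutions and crossing edges\<close>

text \<open>The orbits of \<open>f\<close> partition \<open>S\<close> into two-element blocks: they
  have size two as \<open>f\<close> fixes no point, and blocks that meet coincide as
  \<open>f\<close> is its own inverse.\<close>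

lemma involution_pairs:
  assumes "finite S" "\<And>x. x \<in> S \<Longrightarrow> f x \<in> S" "\<And>x. x \<in> S \<Longrightarrow> f (f x) = x"
    and "\<And>x. x \<in> S \<Longrightarrow> f x \<noteq> x"
  shows "pairwise disjnt ((\<lambda>x. {x, f x}) ` S)" "2 * card ((\<lambda>x. {x, f x}) ` S) = card S"
proof -
  let ?P = "(\<lambda>x. {x, f x}) ` S"
  show disj: "pairwise disjnt ?P"
    unfolding pairwise_def disjnt_def using assms(3) by auto (metis assms(3))+
  have "card e = 2" if "e \<in> ?P" for e
    using that assms(4) by (fastforce simp: card_2_iff)
  then have "card (\<Union>?P) = 2 * card ?P"
    using disj assms(1) by (intro card_Union_pairs) auto
  moreover have "\<Union>?P = S" using assms(2) by auto
  ultimately show "2 * card ?P = card S" by simp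
qed

text \<open>A set of edges rather than a predicate, because the edge to move along will be chosen as
  a function of this whole set.\<close>

definition crossing :: "'a set set \<Rightarrow> 'a set \<Rightarrow> 'a set set" where
  "crossing M A = {e \<in> M. \<not> e \<subseteq> A \<and> \<not> disjnt e A}"

text \<open>Toggling \<open>e\<close> exchanges its points inside and outside \<open>A\<close>, so
  the status of \<open>e\<close> is kept; every other edge of \<open>M\<close> is disjoint from
  \<open>e\<close> and meets \<open>A\<close> as before.\<close>

lemma crossing_sym_diff:
  assumes "pairwise disjnt M" "e \<in> M"
  shows "crossing M (sym_diff A e) = crossing M A"
proof -
  have "(\<not> d \<subseteq> sym_diff A e \<and> \<not> disjnt d (sym_diff A e)) \<longleftrightarrow> (\<not> d \<subseteq> A \<and> \<not> disjnt d A)"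
    if "d \<in> M" for d
  proof (cases "d = e")
    case True
    then show ?thesis by (auto simp: disjnt_def)
  next
    case False
    then have "d \<inter> e = {}" using assms that by (auto simp: pairwise_def disjnt_def)
    then show ?thesis unfolding disjnt_def by blast
  qed
  then show ?thesis unfolding crossing_def by blast
qed

lemma crossing_pairE:
  assumes "e \<in> crossing M A" "card e = 2"
  obtains x y where "e = {x, y}" "x \<in> A" "y \<notin> A"
  using assms by (auto simp: crossing_def card_2_iff disjnt_def)

lemma card_sym_diff_crossing:
  assumes "e \<in> crossing M A" "card e = 2" "finite A"
  shows "card (sym_diff A e) = card A"
proof -
  obtain x y where xy: "e = {x, y}" "x \<in> A" "y \<notin> A"
    using crossing_pairE[OF assms(1,2)] .
  then have "sym_diff A e = insert y (A - {x})" by auto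
  then have "card (sym_diff A e) = Suc (card (A - {x}))" using xy assms(3) by simp
  also have "\<dots> = card A" by (rule card_Suc_Diff1[OF assms(3) xy(2)])
  finally show ?thesis .
qed

text \<open>Distinct finite sets of equal size do not contain one another, so the symmetric
  difference has points both in \<open>A\<close> and outside it.\<close>

lemma mem_crossing_of_sym_diff:
  assumes "sym_diff A B \<in> M" "sym_diff A B \<noteq> {}" "card A = card B" "finite A" "finite B"
  shows "sym_diff A B \<in> crossing M A"
proof -
  have "\<not> A \<subset> B" "\<not> B \<subset> A"
    using psubset_card_mono[of B A] psubset_card_mono[of A B] assms by auto
  then show ?thesis using assms(1,2) unfolding crossing_def disjnt_def by blast
qed

section \<open>Bounding the matching number of the token graph by crossed sets\<close>

lemma crossed_sets_le_matching_number_token_graph: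
  assumes G: "simple_graph G" and M: "matching G M"
  shows "card {A \<in> [verts G]\<^bsup>k\<^esup>. crossing M A \<noteq> {}} \<le> 2 * matching_number (token_graph k G)"
proof -
  let ?S = "{A \<in> [verts G]\<^bsup>k\<^esup>. crossing M A \<noteq> {}}"
  \<comment> \<open>The choice depends on \<open>A\<close> only through \<open>crossing M A\<close>,
    so \<open>A\<close> and \<open>f A\<close> receive the same edge.\<close>
  define c where "c A = (SOME e. e \<in> crossing M A)" for A
  define f where "f A = sym_diff A (c A)" for A
  note Mf = matching_facts[OF G M]
  have finV: "finite (verts G)" using G by (simp add: simple_graph_def)
  have c: "c A \<in> crossing M A" if "A \<in> ?S" for A
    using that unfolding c_def by (auto intro: someI)
  have cM: "c A \<in> M" if "A \<in> ?S" for A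
    using c[OF that] by (simp add: crossing_def)
  have crossing_f: "crossing M (f A) = crossing M A" if "A \<in> ?S" for A
    unfolding f_def by (rule crossing_sym_diff[OF Mf(2) cM[OF that]])
  have f_in: "f A \<in> ?S" if "A \<in> ?S" for A
  proof -
    have "card (f A) = card A"
      unfolding f_def using that
      by (intro card_sym_diff_crossing[OF c Mf(3)[OF cM]]) (auto simp: nsets_def)
    moreover have "f A \<subseteq> verts G"
      using that cM[OF that] Mf(4) by (auto simp: f_def nsets_def)
    ultimately show ?thesis
      using that crossing_f[OF that] finite_subset[OF _ finV] by (auto simp: nsets_def)
  qed
  have c_f: "c (f A) = c A" if "A \<in> ?S" for A
    using crossing_f[OF that] by (simp add: c_def)
  \<comment> \<open>Toggling the same edge twice cancels.\<close>
  have f_f: "f (f A) = A" if "A \<in> ?S" for A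
    using c_f[OF that] by (auto simp: f_def)
  have c_ne: "c A \<noteq> {}" if "A \<in> ?S" for A
    using Mf(3)[OF cM[OF that]] by auto
  have f_ne: "f A \<noteq> A" if "A \<in> ?S" for A
    using c_ne[OF that] by (auto simp: f_def)
  have finS: "finite ?S" using finV by (simp add: finite_imp_finite_nsets)
  let ?P = "(\<lambda>A. {A, f A}) ` ?S"
  note P = involution_pairs[of ?S f, OF finS f_in f_f f_ne]
  have "{A, f A} \<in> edges (token_graph k G)" if A: "A \<in> ?S" for A
  proof -
    have "sym_diff A (f A) = c A" by (auto simp: f_def)
    then have "sym_diff A (f A) \<in> edges G" using cM[OF A] M by (auto simp: matching_def)
    then show ?thesis using A f_in[OF A] by (auto simp: token_graph_def)
  qed
  then have "matching (token_graph k G) ?P"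
    using P(1) unfolding matching_def by blast
  then have "card ?P \<le> matching_number (token_graph k G)"
    by (rule card_matching_le_matching_number[OF simple_graph_token_graph[OF G]])
  then show ?thesis using P(2) by simp
qed

lemma matching_number_token_graph_le_crossed_sets:
  assumes G: "simple_graph G"
  shows "2 * matching_number (token_graph k G) \<le>
    card {A \<in> [verts G]\<^bsup>k\<^esup>. crossing (edges G) A \<noteq> {}}"
proof (rule matching_number_le_half_support[OF simple_graph_token_graph[OF G]])
  show "finite {A \<in> [verts G]\<^bsup>k\<^esup>. crossing (edges G) A \<noteq> {}}"
    using G by (simp add: simple_graph_def finite_imp_finite_nsets)
  have "crossing (edges G) A \<noteq> {}"
    if "A \<in> [verts G]\<^bsup>k\<^esup>" "B \<in> [verts G]\<^bsup>k\<^esup>" "sym_diff A B \<in> edges G" for A B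
  proof -
    have "card (sym_diff A B) = 2"
      using that(3) G by (auto simp: simple_graph_def nsets_def)
    then have "sym_diff A B \<noteq> {}" by (metis card.empty zero_neq_numeral)
    then have "sym_diff A B \<in> crossing (edges G) A"
      using that by (intro mem_crossing_of_sym_diff) (auto simp: nsets_def)
    then show ?thesis by blast
  qed
  \<comment> \<open>The argument is symmetric in \<open>A\<close> and \<open>B\<close>, so both ends
    of a token graph edge are crossed.\<close>
  then show "\<Union>(edges (token_graph k G)) \<subseteq> {A \<in> [verts G]\<^bsup>k\<^esup>. crossing (edges G) A \<noteq> {}}"
    by (force simp: token_graph_def Un_commute)
qed

section \<open>Counting uncrossed sets\<close>

lemma uncrossed_eq_Union:
  assumes "crossing M A = {}"
  shows "A = \<Union>{e \<in> M. e \<subseteq> A} \<union> (A - \<Union>M)"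
  using assms by (auto simp: crossing_def disjnt_def)

lemma card_uncrossed:
  assumes "finite M" "pairwise disjnt M" "\<And>e. e \<in> M \<Longrightarrow> card e = 2"
    and "finite A" "crossing M A = {}"
  shows "card A = 2 * card {e \<in> M. e \<subseteq> A} + card (A - \<Union>M)"
proof -
  let ?N = "{e \<in> M. e \<subseteq> A}"
  have "card A = card (\<Union>?N \<union> (A - \<Union>M))"
    using uncrossed_eq_Union[OF assms(5)] by simp
  also have "\<dots> = card (\<Union>?N) + card (A - \<Union>M)"
    using assms(4) by (intro card_Un_disjoint) (auto intro: finite_subset[of _ A])
  also have "card (\<Union>?N) = 2 * card ?N"
    using assms(1-3) by (intro card_Union_pairs) (auto intro: pairwise_subset)
  finally show ?thesis .
qed

text \<open>
  The hypothesis on \<open>k\<close> excludes only the case that \<open>M\<close> is perfect and \<open>k\<close> is odd.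
\<close>

lemma card_uncrossed_sets:
  assumes V: "finite V" "\<Union>M \<subseteq> V" and M: "finite M" "pairwise disjnt M" "\<And>e. e \<in> M \<Longrightarrow> card e = 2"
    and U: "card (V - \<Union>M) \<le> 1" "k mod 2 \<le> card (V - \<Union>M)"
  shows "card {A \<in> [V]\<^bsup>k\<^esup>. crossing M A = {}} = card M choose (k div 2)"
proof -
  \<comment> \<open>The part outside \<open>\<Union>M\<close> of every uncrossed
    \<open>k\<close>-set: empty for even \<open>k\<close>, the single missed vertex for odd
    \<open>k\<close>.\<close>
  define R where "R = (if even k then {} else V - \<Union>M)"
  have finU: "finite (V - \<Union>M)" using V by simp
  have R: "R \<subseteq> V - \<Union>M" "card R = k mod 2"
    using U by (auto simp: R_def odd_iff_mod_2_eq_one)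
  have R_unique: "R' = R" if "R' \<subseteq> V - \<Union>M" "card R' = k mod 2" for R'
  proof (cases "even k")
    case True
    then show ?thesis using that finite_subset[OF that(1) finU] by (simp add: R_def)
  next
    case False
    then have "R' = V - \<Union>M"
      using that U by (intro card_seteq[OF finU]) (auto simp: odd_iff_mod_2_eq_one)
    then show ?thesis using False by (simp add: R_def)
  qed
  let ?B = "{A \<in> [V]\<^bsup>k\<^esup>. crossing M A = {}}"
  let ?g = "\<lambda>N. \<Union>N \<union> R"
  have edges_of: "{e \<in> M. e \<subseteq> ?g N} = N" if "N \<subseteq> M" for N
  proof -
    have "e \<in> N" if e: "e \<in> M" "e \<subseteq> ?g N" for e
    proof -
      obtain x where x: "x \<in> e" using M(3)[OF e(1)] by fastforce
      \<comment> \<open>As \<open>x\<close> is covered by \<open>M\<close>, it is not in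
        \<open>R\<close>, so it lies in a member of \<open>N\<close>; disjointness then makes that
        member \<open>e\<close>.\<close>
      then obtain d where d: "d \<in> N" "x \<in> d" using e R(1) by auto
      then have "d = e" using x e(1) \<open>N \<subseteq> M\<close> M(2) by (auto simp: pairwise_def disjnt_def)
      then show ?thesis using d by simp
    qed
    then show ?thesis using that by auto
  qed
  have rest: "?g N - \<Union>M = R" if "N \<subseteq> M" for N
    using that R(1) by auto
  have uncr: "crossing M (?g N) = {}" if N: "N \<subseteq> M" for N
  proof -
    have "disjnt e (?g N)" if e: "e \<in> M" "\<not> e \<subseteq> ?g N" for e
    proof -
      have "e \<notin> N" using e by blast
      then have "e \<inter> d = {}" if "d \<in> N" for d
        using that N e(1) pairwiseD[OF M(2), of e d] by (auto simp: disjnt_def)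
      then show ?thesis using e(1) R(1) by (auto simp: disjnt_def)
    qed
    then show ?thesis by (auto simp: crossing_def)
  qed
  have "bij_betw ?g (nsets M (k div 2)) ?B"
  proof (rule bij_betw_byWitness[where f' = "\<lambda>A. {e \<in> M. e \<subseteq> A}"])
    show "\<forall>N\<in>nsets M (k div 2). {e \<in> M. e \<subseteq> ?g N} = N"
      using edges_of by (auto simp: nsets_def)
    have B: "A - \<Union>M = R \<and> card {e \<in> M. e \<subseteq> A} = k div 2" if A: "A \<in> ?B" for A
    proof -
      have sub: "A - \<Union>M \<subseteq> V - \<Union>M" using A by (auto simp: nsets_def)
      then have "card (A - \<Union>M) \<le> 1" using card_mono[OF finU sub] U(1) by simp
      moreover have "k = 2 * card {e \<in> M. e \<subseteq> A} + card (A - \<Union>M)"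
        using A card_uncrossed[OF M, of A] by (auto simp: nsets_def)
      \<comment> \<open>A remainder of at most 1 makes the equation the division of \<open>k\<close>
        by 2.\<close>
      ultimately have "card (A - \<Union>M) = k mod 2" "card {e \<in> M. e \<subseteq> A} = k div 2"
        by presburger+
      then show ?thesis using R_unique[OF sub] by simp
    qed
    then show "\<forall>A\<in>?B. ?g {e \<in> M. e \<subseteq> A} = A"
      using uncrossed_eq_Union[of M] by (metis (mono_tags, lifting) mem_Collect_eq)
    show "?g ` nsets M (k div 2) \<subseteq> ?B"
    proof
      fix A assume "A \<in> ?g ` nsets M (k div 2)"
      then obtain N where N: "N \<subseteq> M" "card N = k div 2" "A = ?g N" by (auto simp: nsets_def)
      have AV: "A \<subseteq> V" using N R(1) V(2) by auto
      then have finA: "finite A" using V(1) finite_subset by blast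
      have "card A = 2 * (k div 2) + k mod 2"
        using card_uncrossed[OF M finA] N uncr edges_of rest R(2) by simp
      then show "A \<in> ?B" using AV finA N uncr by (simp add: nsets_def)
    qed
    show "(\<lambda>A. {e \<in> M. e \<subseteq> A}) ` ?B \<subseteq> nsets M (k div 2)"
      using B M(1) by (auto simp: nsets_def)
  qed
  then have "card ?B = card (nsets M (k div 2))" by (rule bij_betw_same_card[symmetric])
  then show ?thesis by (simp add: card_nsets)
qed

section \<open>Deriving the five assertions from the counts\<close>

theorem theorem1p1:
  fixes G :: "'a ugraph" and n k :: nat
  assumes "simple_graph G"
    and "card (verts G) = n"
    and "1 \<le> k" and "k \<le> n - 1"
    and "matching_number G = n div 2"
  shows
    "(even n \<and> odd k \<longrightarrow>
        real (matching_number (token_graph k G)) = real (n choose k) / 2) \<and>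
     (even n \<and> even k \<longrightarrow>
        real (matching_number (token_graph k G)) \<ge>
          (real (n choose k) - real ((n div 2) choose (k div 2))) / 2) \<and>
     (odd n \<longrightarrow>
        real (matching_number (token_graph k G)) \<ge>
          (real (n choose k) - real (((n - 1) div 2) choose (k div 2))) / 2) \<and>
     (is_perfect_matching G \<and> even k \<longrightarrow>
        real (matching_number (token_graph k G)) =
          (real (n choose k) - real ((n div 2) choose (k div 2))) / 2) \<and>
     (is_almost_perfect_matching G \<longrightarrow>
        real (matching_number (token_graph k G)) =
          (real (n choose k) - real (((n - 1) div 2) choose (k div 2))) / 2)"
proof -
  obtain M where M: "matching G M" "card M = n div 2"
    using obtain_maximum_matching[OF assms(1)] assms(5) by metis
  note Mf = matching_facts[OF assms(1) M(1)]
  have finV: "finite (verts G)" using assms(1) by (simp add: simple_graph_def)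
  have finK: "finite ([verts G]\<^bsup>k\<^esup>)" using finV by (rule finite_imp_finite_nsets)
  have cardK: "card ([verts G]\<^bsup>k\<^esup>) = n choose k" using assms(2) by (simp add: card_nsets)
  define C where "C = {A \<in> [verts G]\<^bsup>k\<^esup>. crossing M A \<noteq> {}}"
  define B where "B = {A \<in> [verts G]\<^bsup>k\<^esup>. crossing M A = {}}"
  let ?nu = "matching_number (token_graph k G)"
  have cardU: "card (verts G - \<Union>M) = n mod 2"
  proof -
    have "card (verts G - \<Union>M) = n - 2 * (n div 2)"
      using Mf finV card_Union_pairs[OF Mf(1-3)] M(2) assms(2)
      by (simp add: card_Diff_subset finite_subset)
    then show ?thesis by presburger
  qed
  have BC: "card B + card C = n choose k"
  proof -
    have "card (B \<union> C) = card B + card C"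
      using finK by (intro card_Un_disjoint) (auto simp: B_def C_def)
    moreover have "B \<union> C = [verts G]\<^bsup>k\<^esup>" by (auto simp: B_def C_def)
    ultimately show ?thesis using cardK by simp
  qed
  have lower: "card C \<le> 2 * ?nu"
    unfolding C_def by (rule crossed_sets_le_matching_number_token_graph[OF assms(1) M(1)])
  \<comment> \<open>With that many edges, \<open>G\<close> has none outside \<open>M\<close>, so
    being crossed by \<open>M\<close> and by \<open>edges G\<close> agree.\<close>
  have upper: "2 * ?nu \<le> card C" if "card (edges G) = n div 2"
  proof -
    have "finite (edges G)"
      using assms(1) finV by (auto simp: simple_graph_def intro: finite_subset finite_imp_finite_nsets)
    then have "edges G = M"
      using that M card_subset_eq[of "edges G" M] by (simp add: matching_def)
    then show ?thesis
      using matching_number_token_graph_le_crossed_sets[OF assms(1), of k] by (simp add: C_def)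
  qed
  have cardB: "card B = (n div 2) choose (k div 2)" if "k mod 2 \<le> n mod 2"
    unfolding B_def using card_uncrossed_sets[OF finV Mf(4) Mf(1-3), of k] that cardU M(2) by simp
  \<comment> \<open>Here \<open>M\<close> is perfect, so an uncrossed set is a union of edges of
    \<open>M\<close> and has even size.\<close>
  have B_empty: "card B = 0" if "even n" "odd k"
  proof -
    have "verts G - \<Union>M = {}" using cardU that(1) finV by simp
    then have "even k" if A: "A \<in> B" for A
    proof -
      have A': "A \<subseteq> verts G" "finite A" "card A = k" "crossing M A = {}"
        using A by (simp_all add: B_def nsets_def)
      have rest: "A - \<Union>M = {}" using \<open>verts G - \<Union>M = {}\<close> A'(1) by blast
      have "card A = 2 * card {e \<in> M. e \<subseteq> A}"
        using card_uncrossed[OF Mf(1-3) A'(2,4)] unfolding rest by simp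
      then have "even (card A)" by (rule dvdI)
      then show ?thesis unfolding A'(3) .
    qed
    then have "B = {}" using that(2) by blast
    then show ?thesis by simp
  qed
  have upper_all: "2 * ?nu \<le> n choose k"
    using matching_number_le_half_support[OF simple_graph_token_graph[OF assms(1)] finK, of k] cardK
    by (auto simp: token_graph_def)
  have half: "(n - 1) div 2 = n div 2" if "odd n" using that by presburger
  have 1: "real ?nu = real (n choose k) / 2" if "even n" "odd k"
    using B_empty[OF that] BC lower upper_all by linarith
  \<comment> \<open>From here on the counts are real, to match the subtraction and the halving in
    the goal.\<close>
  have BC_real: "real (card B) + real (card C) = real (n choose k)"
    using BC by (metis of_nat_add)
  have lower_real: "real (card C) \<le> 2 * real ?nu"
    using lower by (metis of_nat_le_iff of_nat_mult of_nat_numeral)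
  have ge_C: "(real (n choose k) - real (card B)) / 2 \<le> real ?nu"
    using BC_real lower_real by simp
  have eq_C: "real ?nu = (real (n choose k) - real (card B)) / 2" if "card (edges G) = n div 2"
  proof -
    have "card C = 2 * ?nu" using lower upper[OF that] by (rule antisym)
    then have "real (card C) = 2 * real ?nu" by simp
    then show ?thesis using BC_real by simp
  qed
  have ge: "(real (n choose k) - real ((n div 2) choose (k div 2))) / 2 \<le> real ?nu"
    if "k mod 2 \<le> n mod 2"
    using ge_C unfolding cardB[OF that] .
  have eq: "real ?nu = (real (n choose k) - real ((n div 2) choose (k div 2))) / 2"
    if "k mod 2 \<le> n mod 2" "card (edges G) = n div 2"
    using eq_C[OF that(2)] unfolding cardB[OF that(1)] .
  \<comment> \<open>The inequality fails only for even \<open>n\<close> and odd \<open>k\<close>,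
    the case settled by \<open>1\<close>; thus \<open>ge\<close> and \<open>eq\<close> serve all the
    other assertions.\<close>
  have odd_le: "k mod 2 \<le> n mod 2" if "odd n" using that by presburger
  have even_le: "k mod 2 \<le> n mod 2" if "even k" using that by presburger
  show ?thesis
  proof (intro conjI impI)
    assume "even n \<and> odd k"
    then show "real ?nu = real (n choose k) / 2" using 1 by blast
  next
    assume "even n \<and> even k"
    then show "(real (n choose k) - real ((n div 2) choose (k div 2))) / 2 \<le> real ?nu"
      using ge even_le by blast
  next
    assume "odd n"
    then show "(real (n choose k) - real (((n - 1) div 2) choose (k div 2))) / 2 \<le> real ?nu"
      using ge odd_le half by simp
  next
    assume "is_perfect_matching G \<and> even k"
    then show "real ?nu = (real (n choose k) - real ((n div 2) choose (k div 2))) / 2"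
      using eq even_le assms(2) by (simp add: is_perfect_matching_def)
  next
    assume "is_almost_perfect_matching G"
    then show "real ?nu = (real (n choose k) - real (((n - 1) div 2) choose (k div 2))) / 2"
      using eq odd_le half assms(2) by (simp add: is_almost_perfect_matching_def)
  qed
qed

end
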